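(* Let $X$ be a locally compact Polish space, let $\boldsymbol{\mathcal U}=((X_n),(\mathcal U_\alpha),(r^\beta_\alpha))$ be a covering system for $X$, and let $K$ be a countable locally finite simplicial complex with vertex set $\mathrm{dom}(K)=\mathbb N$. Then there is a Borel map $f\mapsto(\alpha_f,p_f)$ from the Polish space $\mathrm{Map}(X,|K|)$ of continuous maps $X\to|K|$ (compact-open topology) to the Polish space $\mathrm{SA}_{\boldsymbol{\mathcal U}}(X,K)$ such that $$f(x)\in\mathrm{St}_K(p_f(U))\quad\text{for all } x\in U\in\mathcal U_{\alpha_f}.$$
   Context: $|K|$ is the topological realization; the open star $\mathrm{St}_K(v)\subseteq|K|$ of a vertex $v$ is the set of points whose barycentric coordinate at $v$ is positive. $\mathcal N^*$ is the set of non-decreasing functions $\mathbb N\to\mathbb N$ (subspace of Baire space), ordered pointwise; $\alpha|n=(\alpha(0),\dots,\alpha(n-1))$; $\mathcal N^*_s=\{\alpha\in\mathcal N^*:\alpha|n=s\}$ for $s$ of length $n$. For a family $\mathcal U$ of open sets and $C\subseteq X$, $\mathcal U\upharpoonright C=\{U\in\mathcal U:U\cap C\neq\emptyset\}$. Write $\mathcal U\preceq\mathcal V$ if there is a refinement map $r:\mathcal V\to\mathcal U$, i.e. $V\subseteq r(V)$ for all $V\in\mathcal V$. A covering system for $X$ is a triple $((X_n),(\mathcal U_\alpha),(r^\beta_\alpha))$ where $\emptyset=X_0\subseteq X_1\subseteq\cdots$ are compact with union $X$; $(\mathcal U_\alpha)_{\alpha\in\mathcal N^*}$ are locally finite open covers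 of $X$; $r^\beta_\alpha:\mathcal U_\beta\to\mathcal U_\alpha$ ($\alpha\le\beta$) are refinement maps with $r^\alpha_\alpha=\mathrm{id}$ and $r^\gamma_\alpha=r^\beta_\alpha\circ r^\gamma_\beta$; and for all $n$: (L1) if $\alpha|n=\beta|n$ then $\mathcal U_\alpha\upharpoonright X_n=\mathcal U_\beta\upharpoonright X_n$; (L2) if $\alpha\le\beta$, $\gamma\le\delta$, $\alpha|n=\gamma|n$, $\beta|n=\delta|n$ then $r^\beta_\alpha$ and $r^\delta_\gamma$ agree on $\mathcal U_\beta\upharpoonright X_n$; (L3) if $\alpha\le\beta$ then $r^\beta_\alpha$ maps $\mathcal U_\beta\upharpoonright X_n$ onto $\mathcal U_\alpha\upharpoonright X_n$; (E1) for every open cover $\mathcal U$ of $X$ and $m>n$, if $\mathcal U\upharpoonright X_n\preceq\mathcal U_\alpha\upharpoonright X_n$ then there is $\beta\in\mathcal N^*_{\alpha|n}$ with $\mathcal U\upharpoonright X_m\preceq\mathcal U_\beta\upharpoonright X_m$. Put $S=\bigcup_{\alpha}\mathcal U_\alpha$ (a countable set, assumed not to contain $\emptyset$) and let $N_\alpha$ be the nerve of $\mathcal U_\alpha$ (finite subsets of $\mathcal U_\alpha$ with nonempty intersection). $\mathrm{SA}_{\boldsymbol{\mathcal U}}(X,K)\subseteq\mathcal N^*\times\mathrm{dom}(K)^S$ (product topology, $\mathrm{dom}(K)$ discrete) is the closed set of pairs $(\alpha,p)$ such that $p|_{\mathcal U_\alpha}$ is a simplicial map $N_\alpha\to K$ and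 $p(U)=0$ for $U\notin\mathcal U_\alpha$. *)

theory Defs
  imports "HOL-Analysis.Analysis"
begin

definition borel_of :: "'a topology \<Rightarrow> 'a measure" where
  "borel_of T = sigma (topspace T) {W. openin T W}"

lemma space_borel_of [simp]: "space (borel_of T) = topspace T"
  by (simp add: borel_of_def openin_subset subset_eq space_measure_of_conv)

lemma sets_borel_of: "sets (borel_of T) = sigma_sets (topspace T) {W. openin T W}"
  unfolding borel_of_def by (rule sets_measure_of) (auto dest: openin_subset)

text \<open>Maps are required to be extensional, so that two elements of the mapping space are equal
  as soon as they agree on the domain space.\<close>

definition maps :: "'a topology \<Rightarrow> 'b topology \<Rightarrow> ('a \<Rightarrow> 'b) set" where
  "maps X Y = {f \<in> extensional (topspace X). continuous_map X Y f}"

definition compact_open :: "'a topology \<Rightarrow> 'b topology \<Rightarrow> ('a \<Rightarrow> 'b) topology" where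
  "compact_open X Y = topology_generated_by
     {{f \<in> maps X Y. f ` C \<subseteq> V} | C V. compactin X C \<and> openin Y V}"

lemma topspace_compact_open [simp]: "topspace (compact_open X Y) = maps X Y"
proof -
  have "maps X Y \<in> {{f \<in> maps X Y. f ` C \<subseteq> V} | C V. compactin X C \<and> openin Y V}"
    by (rule CollectI, rule exI[of _ "{}"], rule exI[of _ "{}"]) auto
  then show ?thesis
    unfolding compact_open_def topology_generated_by_topspace by blast
qed

text \<open>A complex is given by its set of (nonempty) simplices.\<close>

definition abstract_complex :: "'v set set \<Rightarrow> bool" where
  "abstract_complex K \<longleftrightarrow>
     (\<forall>\<sigma>\<in>K. finite \<sigma> \<and> \<sigma> \<noteq> {}) \<and> (\<forall>\<sigma>\<in>K. \<forall>\<tau>. \<tau> \<subseteq> \<sigma> \<and> \<tau> \<noteq> {} \<longrightarrow> \<tau> \<in> K)"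

definition vertices :: "'v set set \<Rightarrow> 'v set" where
  "vertices K = \<Union>K"

definition locally_finite_complex :: "'v set set \<Rightarrow> bool" where
  "locally_finite_complex K \<longleftrightarrow> (\<forall>v\<in>vertices K. finite {\<sigma>\<in>K. v \<in> \<sigma>})"

definition simplicial_map :: "'v set set \<Rightarrow> 'w set set \<Rightarrow> ('v \<Rightarrow> 'w) \<Rightarrow> bool" where
  "simplicial_map L K g \<longleftrightarrow> g ` vertices L \<subseteq> vertices K \<and> (\<forall>\<sigma>\<in>L. g ` \<sigma> \<in> K)"

definition nerve :: "'a set set \<Rightarrow> 'a set set set" where
  "nerve \<U> = {\<F>. \<F> \<subseteq> \<U> \<and> finite \<F> \<and> \<F> \<noteq> {} \<and> \<Inter>\<F> \<noteq> {}}"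

text \<open>A point of the realization is identified with its function of barycentric coordinates.\<close>

definition realization_points :: "'v set set \<Rightarrow> ('v \<Rightarrow> real) set" where
  "realization_points K =
     {x. (\<forall>v. 0 \<le> x v) \<and> {v. x v \<noteq> 0} \<in> K \<and> (\<Sum>v | x v \<noteq> 0. x v) = 1}"

definition closed_simplex :: "'v set \<Rightarrow> ('v \<Rightarrow> real) set" where
  "closed_simplex \<sigma> = {x. (\<forall>v. 0 \<le> x v) \<and> (\<forall>v. v \<notin> \<sigma> \<longrightarrow> x v = 0) \<and> (\<Sum>v\<in>\<sigma>. x v) = 1}"

text \<open>The topology is the weak one, coherent with the closed simplices. On each closed simplex the
  topology of pointwise convergence is the Euclidean one, as only finitely many coordinates
  can be nonzero there.\<close>

definition realization :: "'v set set \<Rightarrow> ('v \<Rightarrow> real) topology" where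
  "realization K = topology (\<lambda>W. W \<subseteq> realization_points K \<and>
     (\<forall>\<sigma>\<in>K. openin (top_of_set (closed_simplex \<sigma>)) (W \<inter> closed_simplex \<sigma>)))"

lemma openin_realization:
  "openin (realization K) W \<longleftrightarrow> W \<subseteq> realization_points K \<and>
     (\<forall>\<sigma>\<in>K. openin (top_of_set (closed_simplex \<sigma>)) (W \<inter> closed_simplex \<sigma>))"
proof -
  let ?P = "\<lambda>W. W \<subseteq> realization_points K \<and>
     (\<forall>\<sigma>\<in>K. openin (top_of_set (closed_simplex \<sigma>)) (W \<inter> closed_simplex \<sigma>))"
  have Int: "?P (S \<inter> T)" if S: "?P S" and T: "?P T" for S T
  proof (intro conjI ballI)
    show "S \<inter> T \<subseteq> realization_points K" using S by blast
    fix \<sigma> assume \<sigma>: "\<sigma> \<in> K"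
    have "openin (top_of_set (closed_simplex \<sigma>))
        ((S \<inter> closed_simplex \<sigma>) \<inter> (T \<inter> closed_simplex \<sigma>))"
      using bspec[OF conjunct2[OF S] \<sigma>] bspec[OF conjunct2[OF T] \<sigma>] by (rule openin_Int)
    moreover have "(S \<inter> closed_simplex \<sigma>) \<inter> (T \<inter> closed_simplex \<sigma>) = S \<inter> T \<inter> closed_simplex \<sigma>"
      by blast
    ultimately show "openin (top_of_set (closed_simplex \<sigma>)) (S \<inter> T \<inter> closed_simplex \<sigma>)"
      by (rule back_subst)
  qed
  have Union: "?P (\<Union>\<K>)" if \<K>: "\<forall>S\<in>\<K>. ?P S" for \<K>
  proof (intro conjI ballI)
    show "\<Union>\<K> \<subseteq> realization_points K" using \<K> by blast
    fix \<sigma> assume "\<sigma> \<in> K"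
    then have "openin (top_of_set (closed_simplex \<sigma>)) (\<Union>((\<lambda>S. S \<inter> closed_simplex \<sigma>) ` \<K>))"
      using \<K> by (intro openin_Union) blast
    moreover have "\<Union>((\<lambda>S. S \<inter> closed_simplex \<sigma>) ` \<K>) = \<Union>\<K> \<inter> closed_simplex \<sigma>"
      by blast
    ultimately show "openin (top_of_set (closed_simplex \<sigma>)) (\<Union>\<K> \<inter> closed_simplex \<sigma>)"
      by (rule back_subst)
  qed
  have "istopology ?P"
    unfolding istopology_def
  proof (rule conjI)
    show "\<forall>S T. ?P S \<longrightarrow> ?P T \<longrightarrow> ?P (S \<inter> T)"
      by (rule allI, rule allI, rule impI, rule impI, rule Int)
    show "\<forall>\<K>. (\<forall>S\<in>\<K>. ?P S) \<longrightarrow> ?P (\<Union>\<K>)"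
      by (rule allI, rule impI, rule Union)
  qed
  then have "openin (realization K) = ?P"
    unfolding realization_def by (rule topology_inverse')
  then show ?thesis by simp
qed

lemma closed_simplex_subset_realization_points:
  assumes "abstract_complex K" "\<sigma> \<in> K"
  shows "closed_simplex \<sigma> \<subseteq> realization_points K"
proof
  fix x assume x: "x \<in> closed_simplex \<sigma>"
  let ?\<tau> = "{v. x v \<noteq> 0}"
  have sub: "?\<tau> \<subseteq> \<sigma>"
    using x unfolding closed_simplex_def by blast
  have fin: "finite \<sigma>" and faces: "\<forall>\<tau>. \<tau> \<subseteq> \<sigma> \<and> \<tau> \<noteq> {} \<longrightarrow> \<tau> \<in> K"
    using assms unfolding abstract_complex_def by blast+
  have sum: "(\<Sum>v\<in>?\<tau>. x v) = 1"
    using x sum.mono_neutral_left[OF fin sub, of x] by (auto simp: closed_simplex_def)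
  then have "?\<tau> \<noteq> {}" by (metis sum.empty zero_neq_one)
  with sub faces have "?\<tau> \<in> K" by blast
  with sum x show "x \<in> realization_points K"
    by (auto simp: realization_points_def closed_simplex_def)
qed

lemma topspace_realization:
  assumes "abstract_complex K"
  shows "topspace (realization K) = realization_points K"
proof
  show "topspace (realization K) \<subseteq> realization_points K"
    using openin_realization[of K "topspace (realization K)"] by simp
  have "realization_points K \<inter> closed_simplex \<sigma> = closed_simplex \<sigma>" if "\<sigma> \<in> K" for \<sigma>
    using closed_simplex_subset_realization_points[OF assms that] by blast
  then have "openin (realization K) (realization_points K)"
    by (simp add: openin_realization)
  then show "realization_points K \<subseteq> topspace (realization K)"
    by (rule openin_subset)
qed

definition open_star :: "'v set set \<Rightarrow> 'v \<Rightarrow> ('v \<Rightarrow> real) set" where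
  "open_star K v = {x \<in> realization_points K. 0 < x v}"

definition Nstar :: "(nat \<Rightarrow> nat) set" where
  "Nstar = {\<alpha>. mono \<alpha>}"

definition init_seg :: "(nat \<Rightarrow> nat) \<Rightarrow> nat \<Rightarrow> nat list" where
  "init_seg \<alpha> n = map \<alpha> [0..<n]"

definition Nstar_cyl :: "nat list \<Rightarrow> (nat \<Rightarrow> nat) set" where
  "Nstar_cyl s = {\<alpha> \<in> Nstar. init_seg \<alpha> (length s) = s}"

definition meeting :: "'a set set \<Rightarrow> 'a set \<Rightarrow> 'a set set" (infixl "\<restriction>\<restriction>" 75) where
  "\<U> \<restriction>\<restriction> C = {U \<in> \<U>. U \<inter> C \<noteq> {}}"

definition refinement_map :: "'a set set \<Rightarrow> 'a set set \<Rightarrow> ('a set \<Rightarrow> 'a set) \<Rightarrow> bool" where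
  "refinement_map \<V> \<U> r \<longleftrightarrow> r \<in> \<V> \<rightarrow> \<U> \<and> (\<forall>V\<in>\<V>. V \<subseteq> r V)"

definition refined_by :: "'a set set \<Rightarrow> 'a set set \<Rightarrow> bool" (infix "\<preceq>" 50) where
  "\<U> \<preceq> \<V> \<longleftrightarrow> (\<exists>r. refinement_map \<V> \<U> r)"

definition open_cover :: "'a topology \<Rightarrow> 'a set set \<Rightarrow> bool" where
  "open_cover X \<U> \<longleftrightarrow> (\<forall>U\<in>\<U>. openin X U) \<and> \<Union>\<U> = topspace X"

text \<open>The families \<open>\<U>\<close> and \<open>r\<close> are constrained only at indices in \<^const>\<open>Nstar\<close>;
  \<open>r \<beta> \<alpha>\<close> is the map from \<open>\<U> \<beta>\<close> to \<open>\<U> \<alpha>\<close>, used only on \<open>\<U> \<beta>\<close>.\<close>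

locale covering_system =
  fixes X :: "'a topology"
    and Xn :: "nat \<Rightarrow> 'a set"
    and \<U> :: "(nat \<Rightarrow> nat) \<Rightarrow> 'a set set"
    and r :: "(nat \<Rightarrow> nat) \<Rightarrow> (nat \<Rightarrow> nat) \<Rightarrow> 'a set \<Rightarrow> 'a set"
  assumes Xn_0: "Xn 0 = {}"
    and Xn_mono: "\<And>n. Xn n \<subseteq> Xn (Suc n)"
    and Xn_compact: "\<And>n. compactin X (Xn n)"
    and Xn_Union: "(\<Union>n. Xn n) = topspace X"
    and cover: "\<And>\<alpha>. \<alpha> \<in> Nstar \<Longrightarrow> open_cover X (\<U> \<alpha>)"
    and cover_locally_finite: "\<And>\<alpha>. \<alpha> \<in> Nstar \<Longrightarrow> locally_finite_in X (\<U> \<alpha>)"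
    and refine: "\<And>\<alpha> \<beta>. \<lbrakk>\<alpha> \<in> Nstar; \<beta> \<in> Nstar; \<alpha> \<le> \<beta>\<rbrakk> \<Longrightarrow> refinement_map (\<U> \<beta>) (\<U> \<alpha>) (r \<beta> \<alpha>)"
    and refine_id: "\<And>\<alpha> U. \<lbrakk>\<alpha> \<in> Nstar; U \<in> \<U> \<alpha>\<rbrakk> \<Longrightarrow> r \<alpha> \<alpha> U = U"
    and refine_comp: "\<And>\<alpha> \<beta> \<gamma> U.
      \<lbrakk>\<alpha> \<in> Nstar; \<beta> \<in> Nstar; \<gamma> \<in> Nstar; \<alpha> \<le> \<beta>; \<beta> \<le> \<gamma>; U \<in> \<U> \<gamma>\<rbrakk>
        \<Longrightarrow> r \<gamma> \<alpha> U = r \<beta> \<alpha> (r \<gamma> \<beta> U)"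
    and L1: "\<And>n \<alpha> \<beta>. \<lbrakk>\<alpha> \<in> Nstar; \<beta> \<in> Nstar; init_seg \<alpha> n = init_seg \<beta> n\<rbrakk>
        \<Longrightarrow> \<U> \<alpha> \<restriction>\<restriction> Xn n = \<U> \<beta> \<restriction>\<restriction> Xn n"
    and L2: "\<And>n \<alpha> \<beta> \<gamma> \<delta> U.
      \<lbrakk>\<alpha> \<in> Nstar; \<beta> \<in> Nstar; \<gamma> \<in> Nstar; \<delta> \<in> Nstar; \<alpha> \<le> \<beta>; \<gamma> \<le> \<delta>;
       init_seg \<alpha> n = init_seg \<gamma> n; init_seg \<beta> n = init_seg \<delta> n; U \<in> \<U> \<beta> \<restriction>\<restriction> Xn n\<rbrakk>
        \<Longrightarrow> r \<beta> \<alpha> U = r \<delta> \<gamma> U"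
    and L3: "\<And>n \<alpha> \<beta>. \<lbrakk>\<alpha> \<in> Nstar; \<beta> \<in> Nstar; \<alpha> \<le> \<beta>\<rbrakk>
        \<Longrightarrow> r \<beta> \<alpha> ` (\<U> \<beta> \<restriction>\<restriction> Xn n) = \<U> \<alpha> \<restriction>\<restriction> Xn n"
    and E1: "\<And>n m \<V> \<alpha>.
      \<lbrakk>open_cover X \<V>; n < m; \<alpha> \<in> Nstar; \<V> \<restriction>\<restriction> Xn n \<preceq> \<U> \<alpha> \<restriction>\<restriction> Xn n\<rbrakk>
        \<Longrightarrow> \<exists>\<beta> \<in> Nstar_cyl (init_seg \<alpha> n). \<V> \<restriction>\<restriction> Xn m \<preceq> \<U> \<beta> \<restriction>\<restriction> Xn m"

definition all_cover_sets :: "((nat \<Rightarrow> nat) \<Rightarrow> 'a set set) \<Rightarrow> 'a set set" where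
  "all_cover_sets \<U> = (\<Union>\<alpha>\<in>Nstar. \<U> \<alpha>)"

definition SA :: "((nat \<Rightarrow> nat) \<Rightarrow> 'a set set) \<Rightarrow> nat set set
    \<Rightarrow> ((nat \<Rightarrow> nat) \<times> ('a set \<Rightarrow> nat)) set" where
  "SA \<U> K = {(\<alpha>, p). \<alpha> \<in> Nstar \<and> p \<in> all_cover_sets \<U> \<rightarrow>\<^sub>E vertices K \<and>
     simplicial_map (nerve (\<U> \<alpha>)) K p \<and> (\<forall>U \<in> all_cover_sets \<U> - \<U> \<alpha>. p U = 0)}"

definition baire :: "(nat \<Rightarrow> nat) topology" where
  "baire = product_topology (\<lambda>_. discrete_topology UNIV) UNIV"

definition SA_space :: "((nat \<Rightarrow> nat) \<Rightarrow> 'a set set) \<Rightarrow> nat set set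
    \<Rightarrow> ((nat \<Rightarrow> nat) \<times> ('a set \<Rightarrow> nat)) topology" where
  "SA_space \<U> K = subtopology
     (prod_topology (subtopology baire Nstar)
       (product_topology (\<lambda>_. discrete_topology (vertices K)) (all_cover_sets \<U>)))
     (SA \<U> K)"

lemma topspace_SA_space [simp]: "topspace (SA_space \<U> K) = SA \<U> K"
  by (auto simp: SA_space_def SA_def baire_def)

end

theory Submission
  imports Defs
begin

text \<open>For a continuous \<open>f\<close> the sets \<open>f\<^sup>-\<^sup>1(St(v))\<close> form an open cover, and (E1) allows one to
  extend any initial segment of length \<open>n\<close> that refines this cover on \<open>X\<^sub>n\<close> by one more entry so that
  the result refines it on \<open>X\<^sub>n\<^sub>+\<^sub>1\<close>. Always taking the first extension in a fixed enumeration of a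
  countable dense subset of \<open>\<N>\<^sup>*\<close> produces \<open>\<alpha>\<^sub>f\<close>, and \<open>p\<^sub>f(U)\<close> is the least \<open>v\<close> with
  \<open>f(U) \<subseteq> St(v)\<close>. Every choice depends on countably many conditions of the form \<open>f(U) \<subseteq> St(v)\<close> with
  \<open>U\<close> open, and these are \<open>G\<^sub>\<delta>\<close> in the compact-open topology because \<open>U\<close> is \<open>\<sigma>\<close>-compact.\<close>

section \<open>Open stars\<close>

text \<open>On each closed simplex, positivity of one coordinate is an open condition for pointwise
  convergence, which is all that the coherent topology asks for.\<close>

lemma openin_open_star:
  assumes "abstract_complex K"
  shows "openin (realization K) (open_star K v)"
  unfolding openin_realization
proof (intro conjI ballI)
  show "open_star K v \<subseteq> realization_points K"
    by (auto simp: open_star_def)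
  fix \<sigma> assume "\<sigma> \<in> K"
  then have eq: "open_star K v \<inter> closed_simplex \<sigma> = closed_simplex \<sigma> \<inter> {x. 0 < x v}"
    using closed_simplex_subset_realization_points[OF assms] by (auto simp: open_star_def)
  have "open {x :: 'a \<Rightarrow> real. 0 < x v}"
    by (intro open_Collect_less continuous_on_const continuous_on_product_coordinates)
  then show "openin (top_of_set (closed_simplex \<sigma>)) (open_star K v \<inter> closed_simplex \<sigma>)"
    unfolding eq by (rule openin_open_Int)
qed

lemma realization_points_in_open_star:
  assumes "abstract_complex K" "x \<in> realization_points K"
  shows "\<exists>v. x \<in> open_star K v"
proof -
  have "{v. x v \<noteq> 0} \<in> K" and nonneg: "\<And>v. 0 \<le> x v"
    using assms(2) by (auto simp: realization_points_def)
  then have "{v. x v \<noteq> 0} \<noteq> {}"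
    using assms(1) unfolding abstract_complex_def by (elim conjE) (drule (1) bspec, simp)
  then obtain v where "x v \<noteq> 0" by blast
  then have "0 < x v" using nonneg[of v] by simp
  with assms(2) show ?thesis
    unfolding open_star_def by blast
qed

text \<open>Every \<open>v\<close> in \<open>V\<close> belongs to the support of \<open>x\<close>,
  which is a simplex, so \<open>V\<close> is a nonempty face of it. This will give the simplicial
  condition in \<open>SA\<close>.\<close>

lemma open_stars_share_simplex:
  assumes "abstract_complex K" "V \<noteq> {}" "\<And>v. v \<in> V \<Longrightarrow> x \<in> open_star K v"
  shows "V \<in> K"
proof -
  have "x \<in> realization_points K"
    using assms(2,3) by (auto simp: open_star_def)
  then have "{v. x v \<noteq> 0} \<in> K"
    by (simp add: realization_points_def)
  moreover have "V \<subseteq> {v. x v \<noteq> 0}"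
    using assms(3) by (force simp: open_star_def)
  ultimately show ?thesis
    using assms(1,2) unfolding abstract_complex_def by blast
qed

section \<open>Borel measurability\<close>

text \<open>An open set is the union of the countably many members of \<open>\<B>\<close> inside it,
  so preimages need to be checked on \<open>\<B>\<close> only; its members may fail to be
  open.\<close>

lemma measurable_borel_of_countable_base:
  assumes "countable \<B>" "f \<in> space M \<rightarrow> topspace T"
    and "\<And>B. B \<in> \<B> \<Longrightarrow> f -` B \<inter> space M \<in> sets M"
    and "\<And>W x. openin T W \<Longrightarrow> x \<in> W \<Longrightarrow> \<exists>B\<in>\<B>. x \<in> B \<and> B \<subseteq> W"
  shows "f \<in> M \<rightarrow>\<^sub>M borel_of T"
  unfolding borel_of_def
proof (rule measurable_measure_of)
  show "{W. openin T W} \<subseteq> Pow (topspace T)"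
    by (auto dest: openin_subset)
  show "f \<in> space M \<rightarrow> topspace T" by fact
  fix W assume W: "W \<in> {W. openin T W}"
  have "W = \<Union>{B\<in>\<B>. B \<subseteq> W}"
    using assms(4)[of W] W by auto
  then have "f -` W \<inter> space M = (\<Union>B\<in>{B\<in>\<B>. B \<subseteq> W}. f -` B \<inter> space M)"
    by (subst (asm) set_eq_iff) auto
  also have "\<dots> \<in> sets M"
    using assms(1,3) by (intro sets.countable_UN'') (auto intro: countable_subset)
  finally show "f -` W \<inter> space M \<in> sets M" .
qed

lemma openin_product_discrete_cylinder:
  assumes "openin (product_topology (\<lambda>_. discrete_topology D) I) W" "p \<in> W"
  shows "\<exists>F. finite F \<and> F \<subseteq> I \<and> (\<forall>q \<in> I \<rightarrow>\<^sub>E D. (\<forall>i\<in>F. q i = p i) \<longrightarrow> q \<in> W)"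
proof -
  obtain B where B: "p \<in> Pi\<^sub>E I B" "finite {i. B i \<noteq> D}" "Pi\<^sub>E I B \<subseteq> W"
    using product_topology_open_contains_basis[OF assms] by auto
  let ?F = "{i. B i \<noteq> D} \<inter> I"
  have "q \<in> W" if q: "q \<in> I \<rightarrow>\<^sub>E D" "\<forall>i\<in>?F. q i = p i" for q
  proof -
    have "q i \<in> B i" if "i \<in> I" for i
      using q B(1) that by (cases "B i = D") (auto simp: PiE_iff)
    with q(1) have "q \<in> Pi\<^sub>E I B" by (auto simp: PiE_iff)
    with B(3) show ?thesis by blast
  qed
  with B(2) show ?thesis by (intro exI[of _ ?F]) auto
qed

lemma openin_SA_space_cylinder:
  assumes "openin (SA_space \<U> K) W" "(\<alpha>, p) \<in> W"
  obtains F G where "finite F" "finite G" "G \<subseteq> all_cover_sets \<U>"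
    "\<forall>(\<beta>, q) \<in> SA \<U> K. (\<forall>i\<in>F. \<beta> i = \<alpha> i) \<and> (\<forall>U\<in>G. q U = p U) \<longrightarrow> (\<beta>, q) \<in> W"
proof -
  obtain T where T: "openin (prod_topology (subtopology baire Nstar)
       (product_topology (\<lambda>_. discrete_topology (vertices K)) (all_cover_sets \<U>))) T"
      "W = T \<inter> SA \<U> K"
    using assms(1) unfolding SA_space_def openin_subtopology by blast
  then obtain V V' where V: "openin (subtopology baire Nstar) V" "\<alpha> \<in> V"
      and V': "openin (product_topology (\<lambda>_. discrete_topology (vertices K)) (all_cover_sets \<U>)) V'"
        "p \<in> V'" and sub: "V \<times> V' \<subseteq> T"
    using assms(2) unfolding openin_prod_topology_alt by blast
  obtain O' where O': "openin baire O'" "V = O' \<inter> Nstar"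
    using V(1) unfolding openin_subtopology by blast
  have "\<alpha> \<in> O'" using V(2) O'(2) by blast
  from openin_product_discrete_cylinder[OF O'(1)[unfolded baire_def] this]
  obtain F where F: "finite F" "\<And>\<beta>. (\<forall>i\<in>F. \<beta> i = \<alpha> i) \<Longrightarrow> \<beta> \<in> O'" by auto
  obtain G where G: "finite G" "G \<subseteq> all_cover_sets \<U>"
    "\<And>q. q \<in> all_cover_sets \<U> \<rightarrow>\<^sub>E vertices K \<Longrightarrow> (\<forall>U\<in>G. q U = p U) \<Longrightarrow> q \<in> V'"
    using openin_product_discrete_cylinder[OF V'] by blast
  have "(\<beta>, q) \<in> W"
    if "(\<beta>, q) \<in> SA \<U> K" "\<forall>i\<in>F. \<beta> i = \<alpha> i" "\<forall>U\<in>G. q U = p U" for \<beta> q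
  proof -
    have "\<beta> \<in> V" "q \<in> V'"
      using that F(2) G(3) by (auto simp: O'(2) SA_def)
    with sub T(2) that(1) show ?thesis by blast
  qed
  with F(1) G(1,2) show thesis
    by (intro that[of F G]) auto
qed

text \<open>Countability of the cover sets leaves only countably many cylinders, and membership in a
  cylinder is a finite conjunction of coordinate conditions.\<close>

lemma measurable_SA_spaceI:
  assumes cS: "countable (all_cover_sets \<U>)"
    and SA: "\<And>f. f \<in> space M \<Longrightarrow> (A f, P f) \<in> SA \<U> K"
    and A: "\<And>i. (\<lambda>f. A f i) \<in> M \<rightarrow>\<^sub>M count_space UNIV"
    and P: "\<And>U. U \<in> all_cover_sets \<U> \<Longrightarrow> (\<lambda>f. P f U) \<in> M \<rightarrow>\<^sub>M count_space UNIV"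
  shows "(\<lambda>f. (A f, P f)) \<in> M \<rightarrow>\<^sub>M borel_of (SA_space \<U> K)"
proof -
  \<comment> \<open>A cylinder is indexed by finite sets of pairs (place, prescribed value).
    Contradictory prescriptions are harmless: they give the empty set.\<close>
  define cyl where "cyl = (\<lambda>(E, H). {(\<beta>, q) \<in> SA \<U> K.
    (\<forall>(i, k) \<in> E. \<beta> i = k) \<and> (\<forall>(U, k) \<in> H. q U = k)})"
  let ?I = "Fpow (UNIV :: (nat \<times> nat) set) \<times> Fpow (all_cover_sets \<U> \<times> (UNIV :: nat set))"
  show ?thesis
  proof (rule measurable_borel_of_countable_base[where \<B> = "cyl ` ?I"])
    show "countable (cyl ` ?I)"
      using cS by (intro countable_image countable_SIGMA countable_Fpow) auto
    show "(\<lambda>f. (A f, P f)) \<in> space M \<rightarrow> topspace (SA_space \<U> K)"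
      using SA by simp
  next
    fix B assume "B \<in> cyl ` ?I"
    then obtain E H where EH: "finite E" "finite H" "H \<subseteq> all_cover_sets \<U> \<times> UNIV"
      "B = cyl (E, H)"
      by (auto simp: Fpow_def)
    have 1: "{f \<in> space M. \<forall>e\<in>E. A f (fst e) = snd e} \<in> sets M"
    proof (rule sets.sets_Collect_finite_All[OF _ EH(1)])
      fix e show "{f \<in> space M. A f (fst e) = snd e} \<in> sets M"
        using measurable_sets[OF A[of "fst e"], of "{snd e}"]
        by (simp add: vimage_def Int_def conj_commute)
    qed
    have 2: "{f \<in> space M. \<forall>e\<in>H. P f (fst e) = snd e} \<in> sets M"
    proof (rule sets.sets_Collect_finite_All[OF _ EH(2)])
      fix e assume "e \<in> H"
      then have "fst e \<in> all_cover_sets \<U>" using EH(3) by auto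
      from measurable_sets[OF P[OF this], of "{snd e}"]
      show "{f \<in> space M. P f (fst e) = snd e} \<in> sets M"
        by (simp add: vimage_def Int_def conj_commute)
    qed
    have "(\<lambda>f. (A f, P f)) -` B \<inter> space M =
        {f \<in> space M. \<forall>e\<in>E. A f (fst e) = snd e} \<inter> {f \<in> space M. \<forall>e\<in>H. P f (fst e) = snd e}"
      using SA by (auto simp: EH(4) cyl_def split_beta)
    with 1 2 show "(\<lambda>f. (A f, P f)) -` B \<inter> space M \<in> sets M" by simp
  next
    fix W x assume W: "openin (SA_space \<U> K) W" "x \<in> W"
    obtain \<alpha> p where x: "x = (\<alpha>, p)" by force
    obtain F G where FG: "finite F" "finite G" "G \<subseteq> all_cover_sets \<U>"
      "\<forall>(\<beta>, q) \<in> SA \<U> K. (\<forall>i\<in>F. \<beta> i = \<alpha> i) \<and> (\<forall>U\<in>G. q U = p U) \<longrightarrow> (\<beta>, q) \<in> W"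
      by (rule openin_SA_space_cylinder[OF W[unfolded x]])
    let ?c = "cyl ((\<lambda>i. (i, \<alpha> i)) ` F, (\<lambda>U. (U, p U)) ` G)"
    have "?c \<in> cyl ` ?I"
      using FG(1-3) by (intro imageI) (auto simp: Fpow_def)
    moreover have "x \<in> ?c"
      using openin_subset[OF W(1)] W(2) by (auto simp: x cyl_def)
    moreover have "?c \<subseteq> W"
      using FG(4) by (auto simp: cyl_def)
    ultimately show "\<exists>B\<in>cyl ` ?I. x \<in> B \<and> B \<subseteq> W" by blast
  qed
qed

text \<open>The condition is a countable intersection of subbasic open sets, one for each compact
  \<open>C k\<close>.\<close>

lemma sets_compact_open_image_subset:
  assumes "openin Y V" "\<And>k :: nat. compactin X (C k)"
  shows "{f \<in> maps X Y. f ` (\<Union>k. C k) \<subseteq> V} \<in> sets (borel_of (compact_open X Y))"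
proof -
  have "{f \<in> maps X Y. f ` C k \<subseteq> V} \<in> sets (borel_of (compact_open X Y))" for k
  proof -
    have "openin (compact_open X Y) {f \<in> maps X Y. f ` C k \<subseteq> V}"
      unfolding compact_open_def using assms
      by (intro topology_generated_by_Basis) blast
    then show ?thesis
      unfolding sets_borel_of by (intro sigma_sets.Basic) simp
  qed
  then have "(\<Inter>k. {f \<in> maps X Y. f ` C k \<subseteq> V}) \<in> sets (borel_of (compact_open X Y))"
    by (intro sets.countable_INT) auto
  moreover have "(\<Inter>k. {f \<in> maps X Y. f ` C k \<subseteq> V}) = {f \<in> maps X Y. f ` (\<Union>k. C k) \<subseteq> V}"
    by blast
  ultimately show ?thesis by simp
qed

section \<open>Initial segments and greedy choices\<close>

lemma init_seg_eq_iff: "init_seg \<alpha> n = init_seg \<beta> n \<longleftrightarrow> (\<forall>i<n. \<alpha> i = \<beta> i)"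
  by (auto simp: init_seg_def)

lemma Nstar_cyl_init_seg:
  "Nstar_cyl (init_seg \<alpha> n) = {\<beta> \<in> Nstar. init_seg \<beta> n = init_seg \<alpha> n}"
  by (simp add: Nstar_cyl_def) (simp add: init_seg_def)

lemma Nstar_dense_sequence:
  "\<exists>d. (\<forall>j :: nat. d j \<in> Nstar) \<and>
    (\<forall>\<alpha>\<in>Nstar. \<forall>n. \<exists>j. init_seg (d j) n = init_seg \<alpha> n)"
proof -
  \<comment> \<open>\<open>L\<close> is countable, being a set of lists of naturals;
    \<open>d\<close> picks one member of each nonempty cylinder.\<close>
  define L where "L = {s. Nstar_cyl s \<noteq> {}}"
  define d where "d j = (SOME \<alpha>. \<alpha> \<in> Nstar_cyl (from_nat_into L j))" for j
  \<comment> \<open>The zero sequence makes \<open>L\<close> nonempty, so that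
    \<open>from_nat_into L\<close> really takes values in \<open>L\<close>.\<close>
  have "(\<lambda>_. 0) \<in> Nstar_cyl []"
    by (simp add: Nstar_cyl_def Nstar_def init_seg_def monoI)
  then have "L \<noteq> {}" by (auto simp: L_def)
  then have d: "d j \<in> Nstar_cyl (from_nat_into L j)" for j
    using from_nat_into[of L j] unfolding d_def some_in_eq by (simp add: L_def)
  show ?thesis
  proof (intro exI[of _ d] conjI allI ballI)
    show "d j \<in> Nstar" for j
      using d[of j] by (simp add: Nstar_cyl_def)
    fix \<alpha> n assume "\<alpha> \<in> Nstar"
    then have "init_seg \<alpha> n \<in> L"
      by (auto simp: L_def Nstar_cyl_init_seg)
    then obtain j where "from_nat_into L j = init_seg \<alpha> n"
      using from_nat_into_surj[of L] by auto
    with d[of j] show "\<exists>j. init_seg (d j) n = init_seg \<alpha> n"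
      by (auto simp: Nstar_cyl_init_seg)
  qed
qed

text \<open>Stage \<open>n\<close> settles the first \<open>n\<close> entries. It records an index
  into \<open>d\<close> instead of a sequence, so that its values are natural numbers. The start
  index 0 is a dummy, since stage 0 settles no entry.\<close>

primrec greedy :: "(nat \<Rightarrow> nat \<Rightarrow> nat) \<Rightarrow> (nat \<Rightarrow> (nat \<Rightarrow> nat) \<Rightarrow> 'f \<Rightarrow> bool) \<Rightarrow> 'f \<Rightarrow> nat \<Rightarrow> nat" where
  "greedy d Q f 0 = 0"
| "greedy d Q f (Suc n) =
    (LEAST j. init_seg (d j) n = init_seg (d (greedy d Q f n)) n \<and> Q (Suc n) (d j) f)"

text \<open>Entry \<open>i\<close> is read off at stage \<open>Suc i\<close>; as long as extensions
  exist, all later stages keep it.\<close>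

definition greedy_limit ::
    "(nat \<Rightarrow> nat \<Rightarrow> nat) \<Rightarrow> (nat \<Rightarrow> (nat \<Rightarrow> nat) \<Rightarrow> 'f \<Rightarrow> bool) \<Rightarrow> 'f \<Rightarrow> nat \<Rightarrow> nat" where
  "greedy_limit d Q f i = d (greedy d Q f (Suc i)) i"

lemma measurable_greedy:
  assumes Q: "\<And>n j. Measurable.pred M (Q n (d j))"
  shows "(\<lambda>f. greedy d Q f n) \<in> M \<rightarrow>\<^sub>M count_space UNIV"
proof (induction n)
  case (Suc n)
  \<comment> \<open>For a fixed previous index \<open>k\<close> this is the least \<open>j\<close>
    satisfying a measurable condition. As \<open>k\<close> ranges over a countable set, the previous
    stage may then be substituted for it.\<close>
  have "(\<lambda>f. LEAST j. init_seg (d j) n = init_seg (d k) n \<and> Q (Suc n) (d j) f)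
      \<in> M \<rightarrow>\<^sub>M count_space UNIV" for k
    using Q by (intro measurable_Least pred_intros_logic) auto
  from measurable_compose_countable[OF this Suc] show ?case by simp
qed simp

lemma measurable_greedy_limit:
  assumes "\<And>n j. Measurable.pred M (Q n (d j))"
  shows "(\<lambda>f. greedy_limit d Q f i) \<in> M \<rightarrow>\<^sub>M count_space UNIV"
proof -
  have "(\<lambda>f. greedy d Q f (Suc i)) \<in> M \<rightarrow>\<^sub>M count_space UNIV"
    using assms by (rule measurable_greedy)
  then show ?thesis
    unfolding greedy_limit_def by (rule measurable_compose) simp
qed

text \<open>By \<open>step\<close> every \<open>LEAST\<close> is attained, so each stage satisfies
  \<open>Q\<close> and keeps the entries settled before; the limit inherits these entries.\<close>

lemma greedy_limit:
  assumes d: "\<And>j. d j \<in> Nstar"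
    and step: "\<And>n j. Q n (d j) f \<Longrightarrow>
      \<exists>k. init_seg (d k) n = init_seg (d j) n \<and> Q (Suc n) (d k) f"
    and Q0: "Q 0 (d 0) f"
  shows "Q n (d (greedy d Q f n)) f" (is ?Q)
    and "init_seg (greedy_limit d Q f) n = init_seg (d (greedy d Q f n)) n" (is ?init)
    and "greedy_limit d Q f \<in> Nstar"
proof -
  have Q: "Q n (d (greedy d Q f n)) f" for n
  proof (induction n)
    case (Suc n)
    from LeastI_ex[OF step[OF Suc]] show ?case by simp
  qed (use Q0 in simp)
  then show ?Q .
  have seg: "init_seg (d (greedy d Q f (Suc n))) n = init_seg (d (greedy d Q f n)) n" for n
    using LeastI_ex[OF step[OF Q]] by simp
  have init: "init_seg (greedy_limit d Q f) n = init_seg (d (greedy d Q f n)) n" for n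
  proof (induction n)
    case (Suc n)
    with seg[of n] show ?case
      unfolding init_seg_eq_iff by (auto simp: less_Suc_eq greedy_limit_def simp del: greedy.simps)
  qed (simp add: init_seg_def)
  then show ?init .
  show "greedy_limit d Q f \<in> Nstar"
    unfolding Nstar_def mem_Collect_eq
  proof (rule monoI)
    fix i j :: nat assume "i \<le> j"
    \<comment> \<open>Entries \<open>i\<close> and \<open>j\<close> of the limit both occur in the
      single non-decreasing sequence chosen at stage \<open>Suc j\<close>.\<close>
    then have "greedy_limit d Q f i = d (greedy d Q f (Suc j)) i"
      using init[of "Suc j"] unfolding init_seg_eq_iff by auto
    also have "\<dots> \<le> greedy_limit d Q f j"
      using d \<open>i \<le> j\<close> by (auto simp: Nstar_def mono_def greedy_limit_def)
    finally show "greedy_limit d Q f i \<le> greedy_limit d Q f j" .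
  qed
qed

section \<open>Covering systems\<close>

text \<open>Finitely many open sets, each meeting only finitely many members of \<open>\<A>\<close>,
  cover \<open>C\<close>.\<close>

lemma finite_meeting_compactin:
  assumes "locally_finite_in X \<A>" "compactin X C"
  shows "finite (\<A> \<restriction>\<restriction> C)"
proof -
  let ?\<O> = "{V. openin X V \<and> finite {U \<in> \<A>. U \<inter> V \<noteq> {}}}"
  have "C \<subseteq> \<Union>?\<O>"
    using assms compactin_subset_topspace[OF assms(2)] unfolding locally_finite_in_def by blast
  then obtain \<F> where \<F>: "finite \<F>" "\<F> \<subseteq> ?\<O>" "C \<subseteq> \<Union>\<F>"
    using compactinD[OF assms(2), of ?\<O>] by blast
  then have "\<A> \<restriction>\<restriction> C \<subseteq> (\<Union>V\<in>\<F>. {U \<in> \<A>. U \<inter> V \<noteq> {}})"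
    unfolding meeting_def by blast
  moreover have "finite (\<Union>V\<in>\<F>. {U \<in> \<A>. U \<inter> V \<noteq> {}})"
    using \<F>(1,2) by blast
  ultimately show ?thesis by (rule finite_subset)
qed

lemma refined_by_meeting_iff:
  "\<V> \<restriction>\<restriction> C \<preceq> \<W> \<restriction>\<restriction> C \<longleftrightarrow> (\<forall>W \<in> \<W> \<restriction>\<restriction> C. \<exists>V\<in>\<V>. W \<subseteq> V)"
proof
  assume "\<forall>W \<in> \<W> \<restriction>\<restriction> C. \<exists>V\<in>\<V>. W \<subseteq> V"
  then obtain \<rho> where "\<forall>W \<in> \<W> \<restriction>\<restriction> C. \<rho> W \<in> \<V> \<and> W \<subseteq> \<rho> W"
    by metis
  then have "refinement_map (\<W> \<restriction>\<restriction> C) (\<V> \<restriction>\<restriction> C) \<rho>"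
    unfolding refinement_map_def meeting_def by blast
  then show "\<V> \<restriction>\<restriction> C \<preceq> \<W> \<restriction>\<restriction> C"
    unfolding refined_by_def by blast
next
  assume "\<V> \<restriction>\<restriction> C \<preceq> \<W> \<restriction>\<restriction> C"
  then obtain \<rho> where "refinement_map (\<W> \<restriction>\<restriction> C) (\<V> \<restriction>\<restriction> C) \<rho>"
    unfolding refined_by_def ..
  then have "\<rho> W \<in> \<V>" "W \<subseteq> \<rho> W" if "W \<in> \<W> \<restriction>\<restriction> C" for W
    using that by (auto simp: refinement_map_def meeting_def Pi_iff)
  then show "\<forall>W \<in> \<W> \<restriction>\<restriction> C. \<exists>V\<in>\<V>. W \<subseteq> V"
    by blast
qed

context covering_system
begin

text \<open>Pointwise form of (L1), used to test membership in the cover of a limit index at a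
  finite stage.\<close>

lemma meeting_Xn_cong:
  assumes "\<alpha> \<in> Nstar" "\<beta> \<in> Nstar" "init_seg \<alpha> n = init_seg \<beta> n" "U \<inter> Xn n \<noteq> {}"
  shows "U \<in> \<U> \<alpha> \<longleftrightarrow> U \<in> \<U> \<beta>"
  using L1[OF assms(1-3)] assms(4) unfolding meeting_def by blast

lemma cover_sets_meet_Xn:
  assumes "U \<in> all_cover_sets \<U>" "U \<noteq> {}"
  obtains n where "U \<inter> Xn n \<noteq> {}"
proof -
  obtain \<alpha> where "\<alpha> \<in> Nstar" "U \<in> \<U> \<alpha>"
    using assms(1) by (auto simp: all_cover_sets_def)
  then have "U \<subseteq> (\<Union>n. Xn n)"
    using cover unfolding open_cover_def Xn_Union by blast
  with assms(2) that show thesis by blast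
qed

text \<open>A nonempty cover set meets some \<open>Xn n\<close>, hence already belongs to the cover
  of some \<open>d j\<close> with the right first \<open>n\<close> entries; for given
  \<open>j\<close> and \<open>n\<close>, only finitely many members meet the compact
  \<open>Xn n\<close>.\<close>

lemma countable_all_cover_sets:
  assumes "{} \<notin> all_cover_sets \<U>"
  shows "countable (all_cover_sets \<U>)"
proof -
  obtain d :: "nat \<Rightarrow> nat \<Rightarrow> nat" where d: "\<And>j. d j \<in> Nstar"
    "\<And>\<alpha> n. \<alpha> \<in> Nstar \<Longrightarrow> \<exists>j. init_seg (d j) n = init_seg \<alpha> n"
    using Nstar_dense_sequence by blast
  have "all_cover_sets \<U> \<subseteq> (\<Union>j. \<Union>n. \<U> (d j) \<restriction>\<restriction> Xn n)"
  proof
    fix U assume U: "U \<in> all_cover_sets \<U>"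
    with assms have "U \<noteq> {}" by blast
    with U obtain n where n: "U \<inter> Xn n \<noteq> {}" by (rule cover_sets_meet_Xn)
    from U obtain \<alpha> where \<alpha>: "\<alpha> \<in> Nstar" "U \<in> \<U> \<alpha>"
      by (auto simp: all_cover_sets_def)
    from d(2)[OF \<alpha>(1)] obtain j where "init_seg (d j) n = init_seg \<alpha> n" by blast
    then have "U \<in> \<U> (d j)"
      using meeting_Xn_cong[OF d(1) \<alpha>(1) _ n] \<alpha>(2) by blast
    with n show "U \<in> (\<Union>j. \<Union>n. \<U> (d j) \<restriction>\<restriction> Xn n)"
      by (auto simp: meeting_def)
  qed
  moreover have "countable (\<Union>j. \<Union>n. \<U> (d j) \<restriction>\<restriction> Xn n)"
    using finite_meeting_compactin[OF cover_locally_finite[OF d(1)] Xn_compact]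
    by (intro countable_UN countableI_type countable_finite)
  ultimately show ?thesis by (rule countable_subset)
qed

lemma openin_cover_set: "U \<in> all_cover_sets \<U> \<Longrightarrow> openin X U"
  using cover by (auto simp: all_cover_sets_def open_cover_def)

text \<open>Open sets of a metrizable space are countable unions of closed sets; intersecting these
  with the sets \<open>Xn n\<close> makes the pieces compact.\<close>

lemma open_sigma_compact:
  assumes "metrizable_space X" "openin X U"
  obtains C :: "nat \<Rightarrow> 'a set" where "\<And>k. compactin X (C k)" "U = (\<Union>k. C k)"
proof -
  obtain D :: "nat \<Rightarrow> 'a set" where D: "\<And>k. closedin X (D k)" "\<Union>(range D) = U"
    using open_imp_fsigma_in[OF assms] unfolding fsigma_in_ascending by blast
  define C where "C k = (case prod_decode k of (i, n) \<Rightarrow> D i \<inter> Xn n)" for k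
  show thesis
  proof (rule that)
    show "compactin X (C k)" for k
      unfolding C_def using closed_Int_compactin[OF D(1) Xn_compact] by (auto split: prod.split)
    have "(\<Union>k. C k) = (\<Union>(i, n). D i \<inter> Xn n)"
      unfolding C_def using surj_prod_decode
      by (metis (no_types, lifting) SUP_cong image_image)
    also have "\<dots> = U \<inter> topspace X"
      unfolding D(2)[symmetric] Xn_Union[symmetric] by auto
    finally show "U = (\<Union>k. C k)"
      using openin_subset[OF assms(2)] by blast
  qed
qed

text \<open>For continuous \<open>f\<close>, this is the refinement hypothesis of (E1) for the cover
  by preimages of open stars, phrased through images so that it reads as a condition on
  \<open>f\<close>.\<close>

definition star_fine :: "nat set set \<Rightarrow> nat \<Rightarrow> (nat \<Rightarrow> nat) \<Rightarrow> ('a \<Rightarrow> nat \<Rightarrow> real) \<Rightarrow> bool" where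
  "star_fine K n \<alpha> f \<longleftrightarrow> (\<forall>U \<in> \<U> \<alpha> \<restriction>\<restriction> Xn n. \<exists>v. f ` U \<subseteq> open_star K v)"

text \<open>This is (E1) with \<open>m = Suc n\<close> for the cover of \<open>X\<close> by
  preimages of open stars.\<close>

lemma star_fine_extend:
  assumes K: "abstract_complex K" and f: "f \<in> maps X (realization K)"
    and \<alpha>: "\<alpha> \<in> Nstar" "star_fine K n \<alpha> f"
  obtains \<beta> where "\<beta> \<in> Nstar" "init_seg \<beta> n = init_seg \<alpha> n" "star_fine K (Suc n) \<beta> f"
proof -
  define \<V> where "\<V> = range (\<lambda>v. {x \<in> topspace X. f x \<in> open_star K v})"
  have cont: "continuous_map X (realization K) f"
    using f by (simp add: maps_def)
  have "f x \<in> realization_points K" if "x \<in> topspace X" for x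
    using continuous_map_image_subset_topspace[OF cont] that topspace_realization[OF K] by blast
  then have "\<Union>\<V> = topspace X"
    using realization_points_in_open_star[OF K] unfolding \<V>_def by blast
  then have ocV: "open_cover X \<V>"
    using openin_continuous_map_preimage[OF cont openin_open_star[OF K]]
    unfolding open_cover_def by (auto simp: \<V>_def)
  have fine: "\<V> \<restriction>\<restriction> Xn m \<preceq> \<U> \<beta> \<restriction>\<restriction> Xn m \<longleftrightarrow> star_fine K m \<beta> f" if "\<beta> \<in> Nstar" for \<beta> m
  proof -
    have "U \<subseteq> topspace X" if "U \<in> \<U> \<beta>" for U
      using cover[OF \<open>\<beta> \<in> Nstar\<close>] that unfolding open_cover_def by blast
    then have "(\<exists>V\<in>\<V>. U \<subseteq> V) \<longleftrightarrow> (\<exists>v. f ` U \<subseteq> open_star K v)" if "U \<in> \<U> \<beta>" for U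
      using that by (simp add: \<V>_def subset_iff image_subset_iff) blast
    then show ?thesis
      unfolding refined_by_meeting_iff star_fine_def by (simp add: meeting_def)
  qed
  obtain \<beta> where "\<beta> \<in> Nstar_cyl (init_seg \<alpha> n)" "\<V> \<restriction>\<restriction> Xn (Suc n) \<preceq> \<U> \<beta> \<restriction>\<restriction> Xn (Suc n)"
    using E1[OF ocV lessI \<alpha>(1)] fine[OF \<alpha>(1)] \<alpha>(2) by blast
  then show thesis
    using that fine by (auto simp: Nstar_cyl_init_seg)
qed

lemma pred_image_subset_open_star:
  assumes "metrizable_space X" "abstract_complex K" "openin X U"
  shows "Measurable.pred (borel_of (compact_open X (realization K))) (\<lambda>f. f ` U \<subseteq> open_star K v)"
proof -
  obtain C :: "nat \<Rightarrow> 'a set" where C: "\<And>k. compactin X (C k)" "U = (\<Union>k. C k)"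
    using open_sigma_compact[OF assms(1,3)] by blast
  show ?thesis
    unfolding pred_def C(2)
    using sets_compact_open_image_subset[OF openin_open_star[OF assms(2)] C(1)] by simp
qed

text \<open>The condition is a finite conjunction, by compactness of \<open>Xn n\<close> and local
  finiteness, of countable disjunctions over the vertices.\<close>

lemma pred_star_fine:
  assumes "metrizable_space X" "abstract_complex K" "\<alpha> \<in> Nstar"
  shows "Measurable.pred (borel_of (compact_open X (realization K))) (star_fine K n \<alpha>)"
proof -
  have "openin X U" if "U \<in> \<U> \<alpha> \<restriction>\<restriction> Xn n" for U
    using that cover[OF assms(3)] by (auto simp: meeting_def open_cover_def)
  moreover have "finite (\<U> \<alpha> \<restriction>\<restriction> Xn n)"
    by (rule finite_meeting_compactin[OF cover_locally_finite[OF assms(3)] Xn_compact])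
  ultimately show ?thesis
    unfolding star_fine_def
    by (intro pred_intros_finite pred_intros_countable pred_image_subset_open_star assms(1,2))
qed

end

section \<open>The selection\<close>

theorem lemma5p5:
  fixes X :: "'a topology"
    and Xn :: "nat \<Rightarrow> 'a set"
    and \<U> :: "(nat \<Rightarrow> nat) \<Rightarrow> 'a set set"
    and r :: "(nat \<Rightarrow> nat) \<Rightarrow> (nat \<Rightarrow> nat) \<Rightarrow> 'a set \<Rightarrow> 'a set"
    and K :: "nat set set"
  assumes "completely_metrizable_space X" and "second_countable X"
    and "locally_compact_space X"
    and "covering_system X Xn \<U> r"
    and "{} \<notin> all_cover_sets \<U>"
    and "abstract_complex K" and "locally_finite_complex K" and "vertices K = UNIV"
  shows "\<exists>(A :: ('a \<Rightarrow> nat \<Rightarrow> real) \<Rightarrow> nat \<Rightarrow> nat) (P :: ('a \<Rightarrow> nat \<Rightarrow> real) \<Rightarrow> 'a set \<Rightarrow> nat).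
    (\<lambda>f. (A f, P f)) \<in> borel_of (compact_open X (realization K)) \<rightarrow>\<^sub>M borel_of (SA_space \<U> K) \<and>
    (\<forall>f \<in> maps X (realization K). \<forall>U \<in> \<U> (A f). \<forall>x \<in> U. f x \<in> open_star K (P f U))"
proof -
  interpret covering_system X Xn \<U> r by fact
  note K = \<open>abstract_complex K\<close>
  have metr: "metrizable_space X"
    using assms(1) by (rule completely_metrizable_imp_metrizable_space)
  let ?M = "borel_of (compact_open X (realization K))"
  obtain d :: "nat \<Rightarrow> nat \<Rightarrow> nat" where d: "\<And>j. d j \<in> Nstar"
    "\<And>\<alpha> n. \<alpha> \<in> Nstar \<Longrightarrow> \<exists>j. init_seg (d j) n = init_seg \<alpha> n"
    using Nstar_dense_sequence by blast
  let ?J = "greedy d (star_fine K)"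
  define A where "A = greedy_limit d (star_fine K)"
  \<comment> \<open>The value 0 off the cover is the one that \<open>SA\<close> prescribes;
    restricting to \<open>all_cover_sets \<U>\<close> makes \<open>P f\<close> extensional.\<close>
  define P where "P f = (\<lambda>U\<in>all_cover_sets \<U>.
    if U \<in> \<U> (A f) then LEAST v. f ` U \<subseteq> open_star K v else 0)" for f

  have mJ: "(\<lambda>f. ?J f n) \<in> ?M \<rightarrow>\<^sub>M count_space UNIV" for n
    by (intro measurable_greedy pred_star_fine metr K d)
  have mA: "(\<lambda>f. A f i) \<in> ?M \<rightarrow>\<^sub>M count_space UNIV" for i
    unfolding A_def by (intro measurable_greedy_limit pred_star_fine metr K d)

  have step: "\<exists>k. init_seg (d k) n = init_seg (d j) n \<and> star_fine K (Suc n) (d k) f"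
    if f: "f \<in> maps X (realization K)" and fine: "star_fine K n (d j) f" for f n j
  proof -
    obtain \<beta> where \<beta>: "\<beta> \<in> Nstar" "init_seg \<beta> n = init_seg (d j) n" "star_fine K (Suc n) \<beta> f"
      using star_fine_extend[OF K f d(1) fine] .
    \<comment> \<open>The match with \<open>\<beta>\<close> extends to \<open>Suc n\<close> entries,
      one more than \<open>d j\<close> prescribes, because by (L1) these decide
      \<open>star_fine\<close> at stage \<open>Suc n\<close>.\<close>
    obtain k where k: "init_seg (d k) (Suc n) = init_seg \<beta> (Suc n)"
      using d(2)[OF \<beta>(1)] by blast
    have "star_fine K (Suc n) (d k) f"
      using \<beta>(3) L1[OF d(1) \<beta>(1) k] by (simp add: star_fine_def)
    moreover have "init_seg (d k) n = init_seg (d j) n"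
      using k \<beta>(2) by (simp add: init_seg_eq_iff)
    ultimately show ?thesis by blast
  qed
  \<comment> \<open>Stage 0 is vacuous because \<open>Xn 0\<close> is empty.\<close>
  have fine0: "star_fine K 0 (d 0) f" for f
    by (simp add: star_fine_def meeting_def Xn_0)
  note limit = greedy_limit[of d "star_fine K", OF d(1) step fine0, folded A_def]
  \<comment> \<open>For \<open>U\<close> meeting \<open>Xn n\<close>, membership in the limit cover
    thus depends on \<open>f\<close> only through the natural number \<open>?J f n\<close>.\<close>
  have A_iff: "U \<in> \<U> (A f) \<longleftrightarrow> U \<in> \<U> (d (?J f n))"
    if "f \<in> maps X (realization K)" "U \<inter> Xn n \<noteq> {}" for f U n
    using meeting_Xn_cong[OF limit(3) d(1) limit(2)] that by blast

  have star: "f ` U \<subseteq> open_star K (P f U)"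
    if f: "f \<in> maps X (realization K)" and U: "U \<in> \<U> (A f)" for f U
  proof -
    have S: "U \<in> all_cover_sets \<U>"
      using U limit(3)[OF f] by (auto simp: all_cover_sets_def)
    with assms(5) have "U \<noteq> {}" by blast
    with S obtain n where n: "U \<inter> Xn n \<noteq> {}" by (rule cover_sets_meet_Xn)
    \<comment> \<open>By \<open>A_iff\<close>, \<open>U\<close> lies in the cover chosen at stage
      \<open>n\<close>, which is star-fine on \<open>Xn n\<close>.\<close>
    then have "\<exists>v. f ` U \<subseteq> open_star K v"
      using limit(1)[OF f, of n] U A_iff[OF f n] unfolding star_fine_def meeting_def by blast
    then show ?thesis
      using S U LeastI_ex by (simp add: P_def)
  qed

  have SA: "(A f, P f) \<in> SA \<U> K" if f: "f \<in> maps X (realization K)" for f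
  proof -
    have "P f ` \<F> \<in> K" if \<F>: "\<F> \<in> nerve (\<U> (A f))" for \<F>
    proof -
      \<comment> \<open>For a common point \<open>x\<close> of the members of \<open>\<F>\<close>,
        the point \<open>f x\<close> lies in all the stars involved.\<close>
      obtain x where x: "x \<in> \<Inter>\<F>" and ne: "\<F> \<noteq> {}" "\<F> \<subseteq> \<U> (A f)"
        using \<F> by (auto simp: nerve_def)
      show ?thesis
      proof (rule open_stars_share_simplex[OF K, where x = "f x"])
        show "P f ` \<F> \<noteq> {}" using ne by simp
        show "f x \<in> open_star K v" if "v \<in> P f ` \<F>" for v
          using that star[OF f] ne(2) x by blast
      qed
    qed
    then have "simplicial_map (nerve (\<U> (A f))) K (P f)"
      using assms(8) by (simp add: simplicial_map_def)
    then show ?thesis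
      using limit(3)[OF f] assms(8) by (auto simp: SA_def P_def)
  qed

  have mP: "(\<lambda>f. P f U) \<in> ?M \<rightarrow>\<^sub>M count_space UNIV" if U: "U \<in> all_cover_sets \<U>" for U
  proof -
    from U assms(5) have "U \<noteq> {}" by blast
    with U obtain n where n: "U \<inter> Xn n \<noteq> {}" by (rule cover_sets_meet_Xn)
    have "(\<lambda>f. LEAST v. f ` U \<subseteq> open_star K v) \<in> ?M \<rightarrow>\<^sub>M count_space UNIV"
      by (intro measurable_Least pred_image_subset_open_star metr K openin_cover_set U)
    \<comment> \<open>With the stage index fixed as \<open>j\<close>, membership in the cover no
      longer depends on \<open>f\<close>; the countably many cases are then glued along
      \<open>mJ\<close>.\<close>
    then have "(\<lambda>f. if U \<in> \<U> (d j) then LEAST v. f ` U \<subseteq> open_star K v else 0)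
        \<in> ?M \<rightarrow>\<^sub>M count_space UNIV" for j
      by (cases "U \<in> \<U> (d j)") auto
    from measurable_compose_countable[OF this mJ[of n]]
    have "(\<lambda>f. if U \<in> \<U> (d (?J f n)) then LEAST v. f ` U \<subseteq> open_star K v else 0)
        \<in> ?M \<rightarrow>\<^sub>M count_space UNIV" .
    \<comment> \<open>Agreement with \<open>P\<close> is needed only on the space of
      \<open>?M\<close>, whose elements are the maps to which \<open>A_iff\<close> applies.\<close>
    then show ?thesis
      by (rule measurable_cong[THEN iffD1, rotated]) (simp add: P_def U A_iff[OF _ n])
  qed

  have "(\<lambda>f. (A f, P f)) \<in> ?M \<rightarrow>\<^sub>M borel_of (SA_space \<U> K)"
    using countable_all_cover_sets[OF assms(5)] SA mA mP
    by (intro measurable_SA_spaceI) auto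
  with star show ?thesis by blast
qed

end
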